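(* Let $G$ be a nontrivial group. Then the following are equivalent. (a) $G$ contains no proper essential subgroup. (b) Every normal subgroup $N$ of $G$ is a direct summand of $G$. (c) Every nontrivial normal subgroup of $G$ contains no proper essential subgroup (that is, no nontrivial normal subgroup $N$ of $G$, regarded as a group, has a proper essential subgroup). (d) There exists a group $\overline{G}$ that does not have a proper essential subgroup and contains a normal subgroup isomorphic to $G$. (e) For every proper normal subgroup $N$ of $G$ and for every normal subgroup $A$ of $G$ containing $N$, there exists a normal subgroup $B$ of $G$ containing $N$ such that $G = AB$ and $A \cap B = N$.
   Context: A normal subgroup $E$ of a group $G$ is called an essential subgroup of $G$ if every nontrivial normal subgroup of $G$ intersects $E$ nontrivially; it is a proper essential subgroup if moreover $E \neq G$. A normal subgroup $N$ of $G$ is a direct summand of $G$ if there is a normal subgroup $T$ of $G$ with $G = NT$ and $N \cap T = \{1\}$. *)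

theory Defs
  imports "HOL-Algebra.Algebra"
begin

definition essential_subgroup :: "'a set \<Rightarrow> ('a, 'm) monoid_scheme \<Rightarrow> bool" where
  "essential_subgroup E G \<longleftrightarrow>
     E \<lhd> G \<and> (\<forall>M. M \<lhd> G \<and> M \<noteq> {\<one>\<^bsub>G\<^esub>} \<longrightarrow> M \<inter> E \<noteq> {\<one>\<^bsub>G\<^esub>})"

definition proper_essential_subgroup :: "'a set \<Rightarrow> ('a, 'm) monoid_scheme \<Rightarrow> bool" where
  "proper_essential_subgroup E G \<longleftrightarrow> essential_subgroup E G \<and> E \<noteq> carrier G"

definition direct_summand :: "'a set \<Rightarrow> ('a, 'm) monoid_scheme \<Rightarrow> bool" where
  "direct_summand N G \<longleftrightarrow>
     N \<lhd> G \<and> (\<exists>T. T \<lhd> G \<and> carrier G = N <#>\<^bsub>G\<^esub> T \<and> N \<inter> T = {\<one>\<^bsub>G\<^esub>})"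

end

theory Submission
  imports Defs
begin

text \<open>
  If \<open>G\<close> has no proper essential subgroup and \<open>N\<close> is normal, Zorn's lemma yields a normal \<open>T\<close>
  maximal subject to meeting \<open>N\<close> trivially; maximality makes \<open>N T\<close> essential, so \<open>N T = G\<close>.
  Conversely, a complement of an essential subgroup is trivial. If \<open>N\<close> is a direct factor of \<open>G\<close>,
  its complement centralizes it, so that normality in \<open>N\<close> implies normality in \<open>G\<close>; complements in
  \<open>G\<close> can therefore be cut down to \<open>N\<close> by the modular law. This yields (c) and (d). In (e) the
  relative complement of \<open>A\<close> over \<open>N\<close> is \<open>N T\<close>, where \<open>T\<close> is a complement of \<open>A\<close>.
\<close>

context group
begin

section \<open>Products of normal subgroups\<close>

lemma set_mult_normal:
  assumes "N \<lhd> G" "T \<lhd> G"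
  shows "N <#> T \<lhd> G"
proof (rule normal_invI)
  interpret N: normal N G by fact
  interpret T: normal T G by fact
  show "subgroup (N <#> T) G"
    using mult_norm_subgroup assms(1) T.subgroup_axioms by blast
  fix x h assume x: "x \<in> carrier G" and "h \<in> N <#> T"
  then obtain n t where nt: "n \<in> N" "t \<in> T" "h = n \<otimes> t"
    by (auto simp: set_mult_def)
  have carr: "n \<in> carrier G" "t \<in> carrier G"
    using nt by auto
  \<comment> \<open>Conjugation by \<open>x\<close> is multiplicative, so each factor can be
    conjugated separately.\<close>
  have "x \<otimes> h \<otimes> inv x = (x \<otimes> n \<otimes> inv x) \<otimes> (x \<otimes> t \<otimes> inv x)"
    using x carr by (simp add: nt m_assoc inv_solve_left)
  moreover have "x \<otimes> n \<otimes> inv x \<in> N" "x \<otimes> t \<otimes> inv x \<in> T"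
    using N.inv_op_closed2 T.inv_op_closed2 nt x by auto
  ultimately show "x \<otimes> h \<otimes> inv x \<in> N <#> T"
    unfolding set_mult_def by blast
qed

lemma subset_set_mult:
  assumes "subgroup N G" "subgroup T G"
  shows "N \<subseteq> N <#> T" "T \<subseteq> N <#> T"
proof -
  interpret N: subgroup N G by fact
  interpret T: subgroup T G by fact
  show "N \<subseteq> N <#> T"
  proof
    fix n assume n: "n \<in> N"
    then have "n = n \<otimes> \<one>"
      by simp
    then show "n \<in> N <#> T"
      using n T.one_closed unfolding set_mult_def by blast
  qed
  show "T \<subseteq> N <#> T"
  proof
    fix t assume t: "t \<in> T"
    then have "t = \<one> \<otimes> t"
      by simp
    then show "t \<in> N <#> T"
      using t N.one_closed unfolding set_mult_def by blast
  qed
qed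

text \<open>Dedekind's modular law. If \<open>e \<otimes> s\<close> lies in \<open>N\<close>,
  cancelling \<open>e\<close>, which is in \<open>N\<close> too, puts \<open>s\<close> in
  \<open>N\<close>.\<close>

lemma set_mult_Int_modular:
  assumes "subgroup N G" "subgroup E G" "subgroup S G" "E \<subseteq> N"
  shows "N \<inter> (E <#> S) = E <#> (N \<inter> S)"
proof
  interpret N: subgroup N G by fact
  interpret E: subgroup E G by fact
  interpret S: subgroup S G by fact
  show "N \<inter> (E <#> S) \<subseteq> E <#> (N \<inter> S)"
  proof
    fix x assume "x \<in> N \<inter> (E <#> S)"
    then obtain e s where es: "x \<in> N" "e \<in> E" "s \<in> S" "x = e \<otimes> s"
      by (auto simp: set_mult_def)
    then have "s = inv e \<otimes> x"
      by (simp add: inv_solve_left)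
    moreover have "inv e \<in> N" "x \<in> N"
      using es assms(4) by auto
    ultimately have "s \<in> N"
      by (metis N.m_closed)
    then show "x \<in> E <#> (N \<inter> S)"
      using es by (auto simp: set_mult_def)
  qed
  show "E <#> (N \<inter> S) \<subseteq> N \<inter> (E <#> S)"
    using assms(4) by (auto simp: set_mult_def)
qed

text \<open>If \<open>x = m \<otimes> t\<close> lies in \<open>N\<close>, then
  \<open>m = x \<otimes> inv t\<close> lies in both \<open>M\<close> and \<open>N <#> T\<close>, so
  \<open>m = \<one>\<close> and \<open>x = t\<close> lies in \<open>N \<inter> T\<close>. This makes
  \<open>M <#> T\<close> a competitor of a maximal \<open>T\<close>.\<close>

lemma Int_set_mult_trivial:
  assumes "subgroup N G" "subgroup M G" "subgroup T G"
    and NT: "N \<inter> T = {\<one>}" and M: "M \<inter> (N <#> T) = {\<one>}"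
  shows "N \<inter> (M <#> T) = {\<one>}"
proof
  interpret N: subgroup N G by fact
  interpret M: subgroup M G by fact
  interpret T: subgroup T G by fact
  show "{\<one>} \<subseteq> N \<inter> (M <#> T)"
    using subset_set_mult[OF assms(2,3)] by auto
  show "N \<inter> (M <#> T) \<subseteq> {\<one>}"
  proof
    fix x assume "x \<in> N \<inter> (M <#> T)"
    then obtain m t where mt: "x \<in> N" "m \<in> M" "t \<in> T" "x = m \<otimes> t"
      by (auto simp: set_mult_def)
    then have "m = x \<otimes> inv t"
      by (simp add: m_assoc)
    then have "m \<in> N <#> T"
      using mt by (auto simp: set_mult_def)
    then have "m = \<one>"
      using M mt by blast
    then have "x \<in> N \<inter> T"
      using mt by simp
    then show "x \<in> {\<one>}"
      using NT by simp
  qed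
qed

section \<open>Maximal normal subgroups with trivial intersection, by Zorn's lemma\<close>

lemma Union_chain_normal:
  assumes "C \<noteq> {}" and chain: "subset.chain {T. T \<lhd> G} C"
  shows "\<Union>C \<lhd> G"
proof (rule normal_invI)
  have normal: "T \<lhd> G" if "T \<in> C" for T
    using chain that by (auto simp: subset.chain_def)
  have sub: "subgroup T G" if "T \<in> C" for T
    using normal[OF that] by (rule normal_imp_subgroup)
  show "subgroup (\<Union>C) G"
  proof (rule subgroupI)
    show "\<Union>C \<subseteq> carrier G"
      using sub subgroup.subset by blast
    show "\<Union>C \<noteq> {}"
      using assms(1) sub subgroup.one_closed by fastforce
    show "inv a \<in> \<Union>C" if "a \<in> \<Union>C" for a
      using that sub subgroup.m_inv_closed by fastforce
    fix a b assume "a \<in> \<Union>C" "b \<in> \<Union>C"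
    then obtain A B where AB: "A \<in> C" "a \<in> A" "B \<in> C" "b \<in> B"
      by blast
    \<comment> \<open>Closure under products is where the chain condition enters: the larger of the
      two members contains both factors.\<close>
    then have "A \<subseteq> B \<or> B \<subseteq> A"
      using chain by (auto simp: subset.chain_def)
    then show "a \<otimes> b \<in> \<Union>C"
      using AB sub subgroup.m_closed by (metis UnionI in_mono)
  qed
  show "x \<otimes> h \<otimes> inv x \<in> \<Union>C" if "x \<in> carrier G" "h \<in> \<Union>C" for x h
    using that normal normal_invE(2) by blast
qed

lemma exists_maximal_normal_trivial_Int:
  assumes "subgroup N G"
  obtains T where "T \<lhd> G" "N \<inter> T = {\<one>}"
    "\<forall>U. U \<lhd> G \<and> N \<inter> U = {\<one>} \<and> T \<subseteq> U \<longrightarrow> U = T"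
proof -
  let ?S = "{T. T \<lhd> G \<and> N \<inter> T = {\<one>}}"
  have "\<exists>T\<in>?S. \<forall>U\<in>?S. T \<subseteq> U \<longrightarrow> U = T"
  proof (rule subset_Zorn_nonempty)
    have "{\<one>} \<in> ?S"
      using one_is_normal subgroup.one_closed[OF assms] by auto
    then show "?S \<noteq> {}"
      by blast
    fix C assume C: "C \<noteq> {}" "subset.chain ?S C"
    have "subset.chain {T. T \<lhd> G} C"
      using C(2) by (auto simp: subset.chain_def)
    \<comment> \<open>Every member of \<open>C\<close> meets \<open>N\<close> in exactly
      \<open>{\<one>}\<close>; nonemptiness of \<open>C\<close> keeps \<open>\<one>\<close> in the
      union.\<close>
    moreover have "N \<inter> \<Union>C = {\<one>}"
      using C by (auto simp: subset.chain_def)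
    ultimately show "\<Union>C \<in> ?S"
      using Union_chain_normal[OF C(1)] by simp
  qed
  then obtain T where "T \<in> ?S" "\<forall>U\<in>?S. T \<subseteq> U \<longrightarrow> U = T"
    by (rule bexE)
  then show ?thesis
    by (intro that[of T]) simp_all
qed

text \<open>A normal \<open>M\<close> meeting \<open>N <#> T\<close> trivially could be used to
  enlarge \<open>T\<close> to \<open>M <#> T\<close>. Maximality then gives
  \<open>M \<subseteq> T\<close>, so \<open>M\<close> lies in \<open>N <#> T\<close> and is
  trivial.\<close>

lemma set_mult_maximal_essential:
  assumes "N \<lhd> G" "T \<lhd> G" "N \<inter> T = {\<one>}"
    and max: "\<forall>U. U \<lhd> G \<and> N \<inter> U = {\<one>} \<and> T \<subseteq> U \<longrightarrow> U = T"
  shows "essential_subgroup (N <#> T) G"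
proof -
  have "M = {\<one>}" if M: "M \<lhd> G" "M \<inter> (N <#> T) = {\<one>}" for M
  proof -
    note subs = assms(1,2)[THEN normal_imp_subgroup] M(1)[THEN normal_imp_subgroup]
    have "N \<inter> (M <#> T) = {\<one>}"
      by (rule Int_set_mult_trivial[OF subs(1,3,2) assms(3) M(2)])
    then have "M <#> T = T"
      using max set_mult_normal[OF M(1) assms(2)] subset_set_mult[OF subs(3,2)] by blast
    then have "M \<subseteq> N <#> T"
      using subset_set_mult[OF subs(3,2)] subset_set_mult[OF subs(1,2)] by blast
    then show ?thesis
      using M(2) by blast
  qed
  then show ?thesis
    using set_mult_normal assms(1,2) unfolding essential_subgroup_def by blast
qed

section \<open>Essential subgroups and direct summands\<close>

lemma direct_summand_if_no_proper_essential:
  assumes "\<nexists>E. proper_essential_subgroup E G" "N \<lhd> G"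
  shows "direct_summand N G"
proof -
  obtain T where T: "T \<lhd> G" "N \<inter> T = {\<one>}"
    "\<forall>U. U \<lhd> G \<and> N \<inter> U = {\<one>} \<and> T \<subseteq> U \<longrightarrow> U = T"
    using normal_imp_subgroup[OF assms(2)] by (rule exists_maximal_normal_trivial_Int)
  have "essential_subgroup (N <#> T) G"
    by (rule set_mult_maximal_essential) (use T assms(2) in auto)
  then have "carrier G = N <#> T"
    using assms(1) unfolding proper_essential_subgroup_def by blast
  then show ?thesis
    unfolding direct_summand_def using assms(2) T by blast
qed

lemma essential_direct_summand_eq_carrier:
  assumes "essential_subgroup E G" "direct_summand E G"
  shows "E = carrier G"
proof -
  obtain T where T: "T \<lhd> G" "carrier G = E <#> T" "E \<inter> T = {\<one>}"
    using assms(2) unfolding direct_summand_def by blast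
  then have "T = {\<one>}"
    using assms(1) by (auto simp: essential_subgroup_def Int_commute)
  moreover have "E \<lhd> G"
    using assms(1) by (simp add: essential_subgroup_def)
  then have "E \<subseteq> carrier G"
    using normal_imp_subgroup subgroup.subset by blast
  \<comment> \<open>With \<open>T = {\<one>}\<close> the product \<open>E <#> T\<close> is the right
    coset of \<open>E\<close> by \<open>\<one>\<close>, that is, \<open>E\<close> itself.\<close>
  ultimately show ?thesis
    using T(2) coset_mult_one[of E] by (simp only: r_coset_eq_set_mult)
qed

lemma no_proper_essential_iff:
  "(\<nexists>E. proper_essential_subgroup E G) \<longleftrightarrow> (\<forall>N. N \<lhd> G \<longrightarrow> direct_summand N G)"
proof
  assume summand: "\<forall>N. N \<lhd> G \<longrightarrow> direct_summand N G"
  have "E = carrier G" if E: "essential_subgroup E G" for E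
  proof (rule essential_direct_summand_eq_carrier[OF E])
    have "E \<lhd> G"
      using E by (simp add: essential_subgroup_def)
    then show "direct_summand E G"
      using summand by simp
  qed
  then show "\<nexists>E. proper_essential_subgroup E G"
    by (auto simp: proper_essential_subgroup_def)
qed (simp add: direct_summand_if_no_proper_essential)

section \<open>Inheritance by normal subgroups\<close>

text \<open>Write \<open>x = n \<otimes> t\<close> along the decomposition. Since \<open>t\<close>
  centralizes \<open>N\<close>, conjugating an element of \<open>E\<close> by \<open>x\<close> is
  the same as conjugating it by \<open>n\<close>.\<close>

lemma normal_in_direct_summand:
  assumes "direct_summand N G" "E \<lhd> G\<lparr>carrier := N\<rparr>"
  shows "E \<lhd> G"
proof (rule normal_invI)
  obtain T where T: "T \<lhd> G" "carrier G = N <#> T" "N \<inter> T = {\<one>}"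
    using assms(1) unfolding direct_summand_def by blast
  interpret N: normal N G
    using assms(1) unfolding direct_summand_def by blast
  interpret T: normal T G by fact
  interpret GN: group "G\<lparr>carrier := N\<rparr>"
    by (rule subgroup_imp_group[OF N.subgroup_axioms])
  have E: "subgroup E (G\<lparr>carrier := N\<rparr>)"
    using assms(2) by (rule normal_imp_subgroup)
  then show "subgroup E G"
    using incl_subgroup N.subgroup_axioms by blast
  fix x h assume x: "x \<in> carrier G" and h: "h \<in> E"
  have hN: "h \<in> N"
    using subgroup.subset[OF E] h by auto
  obtain n t where nt: "n \<in> N" "t \<in> T" "x = n \<otimes> t"
    using x T(2) by (auto simp: set_mult_def)
  \<comment> \<open>Normal subgroups with trivial intersection commute elementwise.\<close>
  have th: "t \<otimes> h = h \<otimes> t"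
    using normal_imp_commuting[OF N.normal_axioms T(1) _ hN nt(2)] T(3) by simp
  have carr: "n \<in> carrier G" "t \<in> carrier G" "h \<in> carrier G"
    using nt hN by auto
  have "x \<otimes> h = n \<otimes> h \<otimes> t"
    using th carr by (simp add: nt m_assoc)
  also have "\<dots> \<otimes> inv x = n \<otimes> h \<otimes> inv n"
    using carr by (simp add: nt(3) inv_mult_group inv_solve_right m_assoc[symmetric]) (simp add: m_assoc)
  \<comment> \<open>Normality of \<open>E\<close> is known inside \<open>N\<close> only, so the
    inverse of \<open>n\<close> there must be identified with its inverse in
    \<open>G\<close>.\<close>
  finally show "x \<otimes> h \<otimes> inv x \<in> E"
    using GN.normal_invE(2)[OF assms(2), of n h] nt(1) h
    by (simp add: m_inv_consistent[OF N.subgroup_axioms])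
qed

text \<open>An essential \<open>E\<close> of \<open>N\<close> is normal in \<open>G\<close>, hence
  has a complement \<open>S\<close> there. Essentiality kills \<open>N \<inter> S\<close>, and the
  modular law gives \<open>N = E <#> (N \<inter> S) = E\<close>.\<close>

lemma no_proper_essential_normal:
  assumes no: "\<nexists>E. proper_essential_subgroup E G" and N: "N \<lhd> G"
  shows "\<nexists>E. proper_essential_subgroup E (G\<lparr>carrier := N\<rparr>)"
proof -
  have "E = N" if E: "essential_subgroup E (G\<lparr>carrier := N\<rparr>)" for E
  proof -
    have EN: "E \<lhd> G\<lparr>carrier := N\<rparr>"
      using E unfolding essential_subgroup_def by blast
    have EG: "E \<lhd> G"
      using normal_in_direct_summand direct_summand_if_no_proper_essential no N EN by blast
    have "E \<subseteq> N"
      using subgroup.subset[OF normal_imp_subgroup[OF EN]] by simp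
    obtain S where S: "S \<lhd> G" "carrier G = E <#> S" "E \<inter> S = {\<one>}"
      using direct_summand_if_no_proper_essential[OF no EG] unfolding direct_summand_def by blast
    note subs = N[THEN normal_imp_subgroup] EG[THEN normal_imp_subgroup]
      S(1)[THEN normal_imp_subgroup]
    have "N \<inter> S \<lhd> G\<lparr>carrier := N\<rparr>"
      using normal_restrict_supergroup[OF subs(1) normal_subgroup_intersect[OF N S(1)]] by blast
    moreover have "(N \<inter> S) \<inter> E = {\<one>}"
      using S(3) \<open>E \<subseteq> N\<close> by blast
    ultimately have "N \<inter> S = {\<one>}"
      using E unfolding essential_subgroup_def by auto
    then have "E <#> (N \<inter> S) = E"
      using coset_mult_one[OF subgroup.subset[OF subs(2)]] by (simp add: r_coset_eq_set_mult)
    moreover have "N \<inter> (E <#> S) = N"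
      using subgroup.subset[OF subs(1)] S(2) by blast
    ultimately show ?thesis
      using set_mult_Int_modular[OF subs(1-3) \<open>E \<subseteq> N\<close>] by simp
  qed
  then show ?thesis
    unfolding proper_essential_subgroup_def by auto
qed

section \<open>Relative complements\<close>

lemma relative_complement_iff_no_proper_essential:
  assumes "carrier G \<noteq> {\<one>}"
  shows "(\<nexists>E. proper_essential_subgroup E G)
    \<longleftrightarrow> (\<forall>N. N \<lhd> G \<and> N \<noteq> carrier G \<longrightarrow>
          (\<forall>A. A \<lhd> G \<and> N \<subseteq> A \<longrightarrow>
            (\<exists>B. B \<lhd> G \<and> N \<subseteq> B \<and> carrier G = A <#> B \<and> A \<inter> B = N)))"
    (is "?a \<longleftrightarrow> ?e")
proof
  assume a: ?a
  have "\<exists>B. B \<lhd> G \<and> N \<subseteq> B \<and> carrier G = A <#> B \<and> A \<inter> B = N"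
    if N: "N \<lhd> G" and A: "A \<lhd> G" and "N \<subseteq> A" for N A
  proof -
    obtain T where T: "T \<lhd> G" "carrier G = A <#> T" "A \<inter> T = {\<one>}"
      using direct_summand_if_no_proper_essential[OF a A] unfolding direct_summand_def by blast
    note subs = N[THEN normal_imp_subgroup] A[THEN normal_imp_subgroup]
      T(1)[THEN normal_imp_subgroup]
    have NT: "N <#> T \<lhd> G"
      by (rule set_mult_normal[OF N T(1)])
    have "A <#> T \<subseteq> A <#> (N <#> T)"
      by (rule mono_set_mult) (use subset_set_mult[OF subs(1,3)] in auto)
    moreover have "A <#> (N <#> T) \<subseteq> carrier G"
      by (intro setmult_subset_G subgroup.subset[OF subs(2)] subgroup.subset[OF normal_imp_subgroup[OF NT]])
    ultimately have "carrier G = A <#> (N <#> T)"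
      using T(2) by blast
    \<comment> \<open>The witness is \<open>B = N <#> T\<close>; the modular law computes its
      intersection with \<open>A\<close>.\<close>
    moreover have "A \<inter> (N <#> T) = N <#> (A \<inter> T)"
      by (rule set_mult_Int_modular) (use subs \<open>N \<subseteq> A\<close> in auto)
    then have "A \<inter> (N <#> T) = N"
      using coset_mult_one[OF subgroup.subset[OF subs(1)]] by (simp add: T(3) r_coset_eq_set_mult)
    ultimately show ?thesis
      using NT subset_set_mult(1)[OF subs(1,3)] by blast
  qed
  then show ?e
    by blast
next
  assume ?e
  \<comment> \<open>Take \<open>N = {\<one>}\<close>, which is proper because \<open>G\<close> is
    nontrivial: a relative complement over it is an ordinary one.\<close>
  then have "direct_summand A G" if "A \<lhd> G" for A
    using that one_is_normal assms subgroup.one_closed[OF normal_imp_subgroup[OF that]]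
    unfolding direct_summand_def by (metis empty_subsetI insert_subset)
  then show ?a
    using no_proper_essential_iff by blast
qed

end

section \<open>Invariance under isomorphism\<close>

lemma iso_proper_essential_subgroup:
  assumes "group G" "group H" and \<phi>: "\<phi> \<in> iso G H" and E: "proper_essential_subgroup E G"
  shows "proper_essential_subgroup (\<phi> ` E) H"
proof -
  interpret G: group G by fact
  interpret H: group H by fact
  interpret group_hom G H \<phi>
    using \<phi> by (simp add: group_hom_def group_hom_axioms_def iso_def)
  have bij: "bij_betw \<phi> (carrier G) (carrier H)"
    using \<phi> by (simp add: iso_def)
  let ?\<psi> = "inv_into (carrier G) \<phi>"
  have \<psi>: "?\<psi> \<in> iso H G"
    using G.iso_set_sym[OF \<phi>] .
  have EG: "E \<lhd> G" "E \<noteq> carrier G"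
    using E unfolding proper_essential_subgroup_def essential_subgroup_def by auto
  then have "E \<subseteq> carrier G"
    using normal_imp_subgroup subgroup.subset by blast
  have "\<phi> ` E \<noteq> carrier H"
    using EG(2) \<open>E \<subseteq> carrier G\<close> bij
    by (metis bij_betw_def inj_on_image_eq_iff order_refl)
  moreover have "\<phi> ` E \<lhd> H"
    using iso_normal_subgroup \<phi> assms(1,2) EG(1) by blast
  moreover have "M \<inter> \<phi> ` E \<noteq> {\<one>\<^bsub>H\<^esub>}" if M: "M \<lhd> H" "M \<noteq> {\<one>\<^bsub>H\<^esub>}" for M
  proof -
    have MH: "M \<subseteq> carrier H"
      using M normal_imp_subgroup subgroup.subset by blast
    have \<phi>\<psi>: "\<phi> ` ?\<psi> ` M = M"
      using image_inv_into_cancel[OF bij_betw_imp_surj_on[OF bij] MH] .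
    \<comment> \<open>Essentiality of \<open>E\<close> is tested on the pullback of
      \<open>M\<close>; a nontrivial common element is then pushed forward by
      \<open>\<phi>\<close>.\<close>
    have "?\<psi> ` M \<lhd> G"
      using iso_normal_subgroup \<psi> assms(1,2) M(1) by blast
    moreover have "?\<psi> ` M \<noteq> {\<one>\<^bsub>G\<^esub>}"
      using M(2) \<phi>\<psi> by auto
    ultimately have "?\<psi> ` M \<inter> E \<noteq> {\<one>\<^bsub>G\<^esub>}"
      using E unfolding proper_essential_subgroup_def essential_subgroup_def by blast
    moreover have "\<one>\<^bsub>G\<^esub> \<in> ?\<psi> ` M \<inter> E"
      using \<open>?\<psi> ` M \<lhd> G\<close> EG(1) normal_imp_subgroup subgroup.one_closed by blast
    ultimately obtain x where x: "x \<in> ?\<psi> ` M" "x \<in> E" "x \<noteq> \<one>\<^bsub>G\<^esub>"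
      by blast
    have "\<phi> x \<in> M \<inter> \<phi> ` E"
      using x \<phi>\<psi> by blast
    moreover have "\<phi> x \<noteq> \<one>\<^bsub>H\<^esub>"
    proof
      assume "\<phi> x = \<one>\<^bsub>H\<^esub>"
      then have "\<phi> x = \<phi> \<one>\<^bsub>G\<^esub>"
        by simp
      then show False
        using x bij \<open>E \<subseteq> carrier G\<close> by (metis G.one_closed bij_betw_def inj_on_def subsetD)
    qed
    ultimately show ?thesis
      by blast
  qed
  ultimately show ?thesis
    unfolding proper_essential_subgroup_def essential_subgroup_def by blast
qed

text \<open>The inverse isomorphism would carry a proper essential subgroup of \<open>G\<close> to
  one of \<open>H\<close>, contradicting inheritance from \<open>K\<close>. The type of
  \<open>K\<close> is independent of that of \<open>G\<close>.\<close>

lemma no_proper_essential_if_iso_normal: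
  assumes "group G" "group K" "\<nexists>E. proper_essential_subgroup E K"
    and "H \<lhd> K" and iso: "K\<lparr>carrier := H\<rparr> \<cong> G"
  shows "\<nexists>E. proper_essential_subgroup E G"
proof -
  interpret K: group K by fact
  have H: "group (K\<lparr>carrier := H\<rparr>)"
    using assms(4) by (intro K.subgroup_imp_group normal_imp_subgroup)
  obtain \<phi> where "\<phi> \<in> iso G (K\<lparr>carrier := H\<rparr>)"
    using group.iso_sym[OF H iso] by (auto simp: is_iso_def)
  then show ?thesis
    using iso_proper_essential_subgroup[OF assms(1) H] K.no_proper_essential_normal assms(3,4)
    by blast
qed

text \<open>Condition (d) asks for a plain \<open>monoid\<close> record, whereas \<open>G\<close>
  may carry extra fields; truncation drops them.\<close>

lemma group_truncate: "group G \<Longrightarrow> group (monoid.truncate G)"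
  by (intro groupI) (auto simp: monoid.defs group.l_inv_ex group.is_monoid monoid.m_assoc
      monoid.m_closed monoid.one_closed monoid.l_one intro: group.l_inv_ex)

lemma id_iso_truncate: "id \<in> iso (monoid.truncate G) G"
  by (auto simp: iso_def hom_def monoid.defs)

(* HOL cannot quantify existentially over types, so "there exists a group Gbar" in (d) appears twice:
   with Gbar on the element type of G, where it is one of the equivalent conditions, and with Gbar
   on an arbitrary element type 'b, where it implies (a). *)
theorem theorem2p11:
  fixes G :: "('a, 'm) monoid_scheme"
  assumes "group G" and "carrier G \<noteq> {\<one>\<^bsub>G\<^esub>}"
  shows
    "((\<nexists>E. proper_essential_subgroup E G)
        \<longleftrightarrow> (\<forall>N. N \<lhd> G \<longrightarrow> direct_summand N G))
   \<and> ((\<nexists>E. proper_essential_subgroup E G)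
        \<longleftrightarrow> (\<forall>N. N \<lhd> G \<and> N \<noteq> {\<one>\<^bsub>G\<^esub>} \<longrightarrow>
              (\<nexists>E. proper_essential_subgroup E (G\<lparr>carrier := N\<rparr>))))
   \<and> ((\<nexists>E. proper_essential_subgroup E G)
        \<longleftrightarrow> (\<exists>Gbar :: 'a monoid. group Gbar
              \<and> (\<nexists>E. proper_essential_subgroup E Gbar)
              \<and> (\<exists>H. H \<lhd> Gbar \<and> Gbar\<lparr>carrier := H\<rparr> \<cong> G)))
   \<and> ((\<exists>Gbar :: 'b monoid. group Gbar
              \<and> (\<nexists>E. proper_essential_subgroup E Gbar)
              \<and> (\<exists>H. H \<lhd> Gbar \<and> Gbar\<lparr>carrier := H\<rparr> \<cong> G))
        \<longrightarrow> (\<nexists>E. proper_essential_subgroup E G))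
   \<and> ((\<nexists>E. proper_essential_subgroup E G)
        \<longleftrightarrow> (\<forall>N. N \<lhd> G \<and> N \<noteq> carrier G \<longrightarrow>
              (\<forall>A. A \<lhd> G \<and> N \<subseteq> A \<longrightarrow>
                (\<exists>B. B \<lhd> G \<and> N \<subseteq> B \<and> carrier G = A <#>\<^bsub>G\<^esub> B \<and> A \<inter> B = N))))"
proof -
  interpret G: group G by fact
  let ?a = "\<nexists>E. proper_essential_subgroup E G"
  let ?d = "\<lambda>K. group K \<and> (\<nexists>E. proper_essential_subgroup E K) \<and> (\<exists>H. H \<lhd> K \<and> K\<lparr>carrier := H\<rparr> \<cong> G)"
  have c: "?a" if "\<forall>N. N \<lhd> G \<and> N \<noteq> {\<one>\<^bsub>G\<^esub>} \<longrightarrow>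
      (\<nexists>E. proper_essential_subgroup E (G\<lparr>carrier := N\<rparr>))"
    \<comment> \<open>The group itself is one of its nontrivial normal subgroups.\<close>
    using that[rule_format, of "carrier G"] G.normal_self assms(2) by simp
  have d: "?d (monoid.truncate G)" if ?a
  proof (intro conjI exI)
    show T: "group (monoid.truncate G)"
      by (rule group_truncate[OF assms(1)])
    show "\<nexists>E. proper_essential_subgroup E (monoid.truncate G)"
      using iso_proper_essential_subgroup[OF T assms(1) id_iso_truncate] that by blast
    \<comment> \<open>The witness for \<open>H\<close> is the whole truncated group.\<close>
    show "carrier (monoid.truncate G) \<lhd> monoid.truncate G"
      by (rule group.normal_self[OF T])
    show "(monoid.truncate G)\<lparr>carrier := carrier (monoid.truncate G)\<rparr> \<cong> G"
      using id_iso_truncate[of G] by (auto simp: is_iso_def)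
  qed
  have d': ?a if "?d K" for K :: "'a monoid"
    using no_proper_essential_if_iso_normal[OF assms(1), of K] that by blast
  have d'': ?a if "?d K" for K :: "'b monoid"
    using no_proper_essential_if_iso_normal[OF assms(1), of K] that by blast
  show ?thesis
  proof (intro conjI)
    show "?a \<longleftrightarrow> (\<forall>N. N \<lhd> G \<longrightarrow> direct_summand N G)"
      by (rule G.no_proper_essential_iff)
    show "?a \<longleftrightarrow> (\<forall>N. N \<lhd> G \<and> N \<noteq> {\<one>\<^bsub>G\<^esub>} \<longrightarrow>
        (\<nexists>E. proper_essential_subgroup E (G\<lparr>carrier := N\<rparr>)))"
      using c G.no_proper_essential_normal by blast
    show "?a \<longleftrightarrow> (\<exists>K :: 'a monoid. ?d K)"
      using d d' by blast
    show "(\<exists>K :: 'b monoid. ?d K) \<longrightarrow> ?a"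
      using d'' by blast
    show "?a \<longleftrightarrow> (\<forall>N. N \<lhd> G \<and> N \<noteq> carrier G \<longrightarrow>
        (\<forall>A. A \<lhd> G \<and> N \<subseteq> A \<longrightarrow>
          (\<exists>B. B \<lhd> G \<and> N \<subseteq> B \<and> carrier G = A <#>\<^bsub>G\<^esub> B \<and> A \<inter> B = N)))"
      by (rule G.relative_complement_iff_no_proper_essential[OF assms(2)])
  qed
qed

end
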